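(* Let $C$ be an $n$-dimensional extreme value copula, that is, a copula satisfying $$C(u_1^{1/m},\dots,u_n^{1/m})^m=C(u_1,\dots,u_n)\qquad\text{for all integers } m\ge1 \text{ and all }(u_1,\dots,u_n)\in[0,1]^n.$$ Then the weak lower tail dependence function $\chi$ of $C$ exists and, for all $\lambda_1,\dots,\lambda_n\ge0$ not all zero, $$\chi(\lambda_1,\dots,\lambda_n)=-\frac{\max_i\lambda_i}{\ln C(e^{-\lambda_1},\dots,e^{-\lambda_n})}.$$
   Context: A copula is a distribution function $C:[0,1]^n\to[0,1]$ of a random vector with uniform margins on $[0,1]$. The weak lower tail dependence function of a copula $C$ is $$\chi(\lambda_1,\dots,\lambda_n)=\lim_{u\downarrow0}\frac{\min_i\ln u^{\lambda_i}}{\ln C(u^{\lambda_1},\dots,u^{\lambda_n})},$$ for $\lambda_1,\dots,\lambda_n\ge0$ not all zero, whenever the limit exists, with the convention that if the copula value is $0$ its logarithm is infinite and the ratio is $0$. *)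

theory Defs
  imports "HOL-Probability.Probability"
begin

text \<open>
  The measure \<open>M\<close> is the law of the random vector. The order on \<open>real ^ 'n\<close> is componentwise, so
  \<open>{0..1}\<close> is the unit cube and \<open>measure M {..u}\<close> is the joint distribution function at \<open>u\<close>.
  A copula is constrained only on the unit cube; its values elsewhere are irrelevant.
\<close>

definition copula :: "(real ^ 'n \<Rightarrow> real) \<Rightarrow> bool" where
  "copula C \<longleftrightarrow>
    (\<exists>M :: (real ^ 'n) measure.
       prob_space M \<and> sets M = sets borel \<and>
       (\<forall>i. distr M borel (\<lambda>x. x $ i) = uniform_measure lborel {0..1}) \<and>
       (\<forall>u\<in>{0..1}. C u = measure M {..u}))"

text \<open>The value \<open>0 powr (1 / real m) = 0\<close> is the intended one on the boundary of the cube.\<close>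

definition extreme_value_copula :: "(real ^ 'n \<Rightarrow> real) \<Rightarrow> bool" where
  "extreme_value_copula C \<longleftrightarrow>
    copula C \<and>
    (\<forall>m::nat. m \<ge> 1 \<longrightarrow> (\<forall>u\<in>{0..1}. C (\<chi> i. u $ i powr (1 / real m)) ^ m = C u))"

definition tail_ratio :: "(real ^ 'n \<Rightarrow> real) \<Rightarrow> real ^ 'n \<Rightarrow> real \<Rightarrow> real" where
  "tail_ratio C l u =
    (if C (\<chi> i. u powr (l $ i)) = 0 then 0
     else (MIN i. ln (u powr (l $ i))) / ln (C (\<chi> i. u powr (l $ i))))"

definition tail_directions :: "(real ^ 'n) set" where
  "tail_directions = {l. (\<forall>i. l $ i \<ge> 0) \<and> (\<exists>i. l $ i \<noteq> 0)}"

definition has_weak_lower_tail_dependence :: "(real ^ 'n \<Rightarrow> real) \<Rightarrow> bool" where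
  "has_weak_lower_tail_dependence C \<longleftrightarrow>
    (\<forall>l\<in>tail_directions. \<exists>L. (tail_ratio C l \<longlongrightarrow> L) (at_right 0))"

text \<open>Meaningful only at those \<open>l\<close> for which the limit exists.\<close>

definition weak_lower_tail_dependence :: "(real ^ 'n \<Rightarrow> real) \<Rightarrow> real ^ 'n \<Rightarrow> real" where
  "weak_lower_tail_dependence C l = Lim (at_right 0) (tail_ratio C l)"

end

theory Submission
  imports Defs
begin

text \<open>
  Along the ray through \<open>l\<close> the function \<open>F t = C (\<chi> i. exp (- (t * l $ i)))\<close> is antitone and
  max-stability reads \<open>F t ^ m = F (m t)\<close>. Monotone solutions of this equation are
  \<open>F t = F 1 powr t\<close>, so with \<open>t = - ln u\<close> the quotient defining the tail dependence function
  does not depend on \<open>u \<in> (0, 1)\<close>.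
\<close>

lemma eq_0_if_of_nat_mult_bounded:
  fixes x c :: real
  assumes "\<And>n::nat. n \<ge> 1 \<Longrightarrow> real n * \<bar>x\<bar> \<le> c"
  shows "x = 0"
proof (rule ccontr)
  assume "x \<noteq> 0"
  then obtain n :: nat where n: "c < real n * \<bar>x\<bar>"
    using reals_Archimedean3[of "\<bar>x\<bar>"] by auto
  have "real n * \<bar>x\<bar> \<le> real (Suc n) * \<bar>x\<bar>"
    by (intro mult_right_mono) auto
  with n assms[of "Suc n"] show False
    by simp
qed

text \<open>Monotonicity replaces continuity: \<open>n * t\<close> is trapped between consecutive
  integers, where the values of \<open>F\<close> are powers of \<open>F 1\<close>, and
  \<open>n\<close> is arbitrary. The point \<open>t = 0\<close> is excluded because
  \<open>0 powr 0 = 0\<close>, while \<open>F 0\<close> may be 1 when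
  \<open>F 1 = 0\<close>.\<close>

lemma antitone_power_law:
  fixes F :: "real \<Rightarrow> real"
  assumes anti: "\<And>s t. 0 \<le> s \<Longrightarrow> s \<le> t \<Longrightarrow> F t \<le> F s"
    and nonneg: "\<And>t. 0 \<le> t \<Longrightarrow> 0 \<le> F t"
    and le1: "F 1 \<le> 1"
    and power: "\<And>(m::nat) t. m \<ge> 1 \<Longrightarrow> 0 \<le> t \<Longrightarrow> F t ^ m = F (real m * t)"
    and t: "0 < t"
  shows "F t = F 1 powr t"
proof (cases "F 1 = 0")
  case True
  \<comment> \<open>Beyond 1 the function vanishes, and a power of \<open>F t\<close> is a value of
    \<open>F\<close> there.\<close>
  obtain n :: nat where n: "1 < real n * t"
    using reals_Archimedean3[OF t] by auto
  then have "n \<ge> 1"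
    by (cases n) auto
  then have "F t ^ n \<le> 0"
    using anti[of 1 "real n * t"] n power[of n t] t True by simp
  with nonneg[of t] t have "F t = 0"
    by (metis less_le not_less zero_less_power)
  with True show ?thesis
    by simp
next
  case False
  with nonneg[of 1] have a: "0 < F 1"
    by simp
  have nat: "F (real k) = F 1 ^ k" if "k \<ge> 1" for k :: nat
    using power[of k 1] that by simp
  have pos: "0 < F s" if "0 \<le> s" for s
  proof -
    have "F (real (Suc (nat \<lceil>s\<rceil>))) \<le> F s"
      using that by (intro anti) linarith+
    with nat[of "Suc (nat \<lceil>s\<rceil>)"] a show ?thesis
      by (metis le_add1 plus_1_eq_Suc less_le_trans zero_less_power)
  qed
  \<comment> \<open>The value at 0 is idempotent and positive. It is needed because the integer part
    \<open>k\<close> below is 0 when \<open>n * t < 1\<close>.\<close>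
  have "F 0 = 1"
    using power[of 2 0] pos[of 0] by (simp add: power2_eq_square)
  with nat have nat0: "F (real k) = F 1 ^ k" for k :: nat
    by (cases "k = 0") auto
  have lna: "ln (F 1) \<le> 0"
    using a le1 by simp
  \<comment> \<open>Both \<open>n * ln (F t)\<close> and \<open>n * t * ln (F 1)\<close> lie between
    \<open>(k + 1) * ln (F 1)\<close> and \<open>k * ln (F 1)\<close>, an interval whose length does
    not depend on \<open>n\<close>.\<close>
  have bound: "real n * \<bar>ln (F t) - t * ln (F 1)\<bar> \<le> - ln (F 1)" if "n \<ge> 1" for n :: nat
  proof -
    define k where "k = nat \<lfloor>real n * t\<rfloor>"
    have nt: "0 \<le> real n * t"
      using t by simp
    then have k: "real k \<le> real n * t" "real n * t \<le> real (Suc k)"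
      unfolding k_def by linarith+
    have eq: "ln (F (real n * t)) = real n * ln (F t)"
      using power[OF that, of t] t pos[of t] by (metis less_imp_le ln_realpow)
    have "ln (F (real n * t)) \<le> ln (F (real k))"
      using anti[OF _ k(1)] pos[OF nt] pos[of "real k"] by simp
    then have up: "real n * ln (F t) \<le> real k * ln (F 1)"
      using eq nat0[of k] a by (simp add: ln_realpow)
    have "ln (F (real (Suc k))) \<le> ln (F (real n * t))"
      using anti[OF nt k(2)] pos[OF nt] pos[of "real (Suc k)"] by simp
    then have lo: "real (Suc k) * ln (F 1) \<le> real n * ln (F t)"
      using eq nat0[of "Suc k"] a by (metis ln_realpow)
    have "real n * t * ln (F 1) \<le> real k * ln (F 1)"
      "real (Suc k) * ln (F 1) \<le> real n * t * ln (F 1)"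
      using k lna by (auto intro!: mult_right_mono_neg simp del: of_nat_Suc)
    with up lo have "\<bar>real n * ln (F t) - real n * t * ln (F 1)\<bar> \<le> - ln (F 1)"
      by (simp add: algebra_simps abs_le_iff)
    moreover have "real n * \<bar>ln (F t) - t * ln (F 1)\<bar> = \<bar>real n * ln (F t) - real n * t * ln (F 1)\<bar>"
      by (metis abs_mult abs_of_nat mult.assoc right_diff_distrib)
    ultimately show ?thesis
      by simp
  qed
  have "ln (F t) = t * ln (F 1)"
    using eq_0_if_of_nat_mult_bounded[OF bound] by simp
  then show ?thesis
    using pos[of t] t a by (metis exp_ln less_imp_le less_irrefl powr_def)
qed

lemma copula_mono:
  assumes "copula C" "u \<in> {0..1}" "v \<in> {0..1}" "u \<le> v"
  shows "C u \<le> C v"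
proof -
  obtain M :: "(real ^ 'a) measure" where M: "prob_space M" "sets M = sets borel"
    "\<forall>u\<in>{0..1}. C u = measure M {..u}"
    using assms(1) unfolding copula_def by blast
  interpret prob_space M by fact
  have "measure M {..u} \<le> measure M {..v}"
    using assms(4) M(2) by (intro finite_measure_mono) auto
  with M(3) assms show ?thesis
    by simp
qed

lemma copula_nonneg:
  assumes "copula C" "u \<in> {0..1}"
  shows "0 \<le> C u"
  using assms unfolding copula_def by (metis measure_nonneg)

lemma copula_le_1:
  assumes "copula C" "u \<in> {0..1}"
  shows "C u \<le> 1"
  using assms unfolding copula_def by (metis prob_space.prob_le_1)

lemma extreme_value_copula_ray:
  fixes C :: "real ^ 'n \<Rightarrow> real"
  assumes C: "extreme_value_copula C" and l: "\<And>i. 0 \<le> l $ i" and t: "0 < t"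
  shows "C (\<chi> i. exp (- (t * l $ i))) = C (\<chi> i. exp (- (l $ i))) powr t"
proof -
  have cop: "copula C"
    and evc: "\<And>(m::nat) u. m \<ge> 1 \<Longrightarrow> u \<in> {0..1} \<Longrightarrow> C (\<chi> i. u $ i powr (1 / real m)) ^ m = C u"
    using C unfolding extreme_value_copula_def by auto
  define r :: "real \<Rightarrow> real ^ 'n" where "r s = (\<chi> i. exp (- (s * l $ i)))" for s
  have cube: "r s \<in> {0..1}" if "0 \<le> s" for s
    using that l by (simp add: r_def less_eq_vec_def)
  have anti: "C (r s') \<le> C (r s)" if "0 \<le> s" "s \<le> s'" for s s'
    using that l
    by (intro copula_mono[OF cop] cube) (auto simp: r_def less_eq_vec_def intro: mult_right_mono)
  have power: "C (r s) ^ m = C (r (real m * s))" if "m \<ge> 1" "0 \<le> s" for m s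
  proof -
    \<comment> \<open>Taking \<open>m\<close>-th roots of the coordinates divides the ray parameter
      by \<open>m\<close>.\<close>
    have "(\<chi> i. r (real m * s) $ i powr (1 / real m)) = r s"
      using that by (simp add: r_def vec_eq_iff powr_def)
    then show ?thesis
      using evc[OF that(1) cube[of "real m * s"]] that by simp
  qed
  have "C (r t) = C (r 1) powr t"
    using anti copula_nonneg[OF cop cube] copula_le_1[OF cop cube] power t
    by (intro antitone_power_law[where F = "\<lambda>s. C (r s)"]) auto
  then show ?thesis
    by (simp add: r_def)
qed

text \<open>By the power law on the ray, numerator and denominator are both multiples of
  \<open>ln u\<close>, which cancels.\<close>

lemma tail_ratio_eq:
  fixes C :: "real ^ 'n \<Rightarrow> real"
  assumes C: "extreme_value_copula C" and l: "\<And>i. 0 \<le> l $ i" and u: "0 < u" "u < 1"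
  shows "tail_ratio C l u = - ((MAX i. l $ i) / ln (C (\<chi> i. exp (- (l $ i)))))"
proof -
  define a where "a = C (\<chi> i. exp (- (l $ i)))"
  have ln: "ln u < 0"
    using u by simp
  have "(\<chi> i. u powr (l $ i)) = (\<chi> i. exp (- (- ln u * l $ i)))"
    using u by (simp add: vec_eq_iff powr_def mult.commute)
  then have Cu: "C (\<chi> i. u powr (l $ i)) = a powr (- ln u)"
    using extreme_value_copula_ray[OF C l, of "- ln u"] ln by (simp add: a_def)
  have "(MAX i. l $ i) \<in> range (\<lambda>i. l $ i)"
    by (intro Max_in) auto
  then obtain j where j: "(MAX i. l $ i) = l $ j"
    by blast
  have "l $ i \<le> l $ j" for i
    unfolding j[symmetric] by (intro Max_ge) auto
  \<comment> \<open>The factor \<open>ln u\<close> is negative, so the largest exponent gives the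
    minimum.\<close>
  with j have "(MIN i. l $ i * ln u) = (MAX i. l $ i) * ln u"
    using ln by (intro Min_eqI) (auto intro: mult_right_mono_neg)
  then have min: "(MIN i. ln (u powr (l $ i))) = (MAX i. l $ i) * ln u"
    using u by (simp add: ln_powr)
  show ?thesis
  proof (cases "a = 0")
    \<comment> \<open>The left side is 0 by the convention in \<open>tail_ratio\<close>; the right
      side is 0 because \<open>ln 0 = 0\<close> and division by zero gives 0.\<close>
    case True
    then show ?thesis
      using Cu by (simp add: tail_ratio_def flip: a_def)
  next
    \<comment> \<open>If \<open>a = 1\<close>, both quotients have denominator 0 and hence value 0,
      so this case needs no separate treatment.\<close>
    case False
    then show ?thesis
      using Cu ln min by (simp add: tail_ratio_def ln_powr flip: a_def)
  qed
qed

theorem mainTheorem8: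
  fixes C :: "real ^ 'n \<Rightarrow> real"
  assumes "extreme_value_copula C"
  shows "has_weak_lower_tail_dependence C \<and>
    (\<forall>l\<in>tail_directions.
       weak_lower_tail_dependence C l = - ((MAX i. l $ i) / ln (C (\<chi> i. exp (- (l $ i))))))"
proof -
  have lim: "(tail_ratio C l \<longlongrightarrow> - ((MAX i. l $ i) / ln (C (\<chi> i. exp (- (l $ i)))))) (at_right 0)"
    if "l \<in> tail_directions" for l
  proof (rule tendsto_eventually)
    show "\<forall>\<^sub>F u in at_right 0. tail_ratio C l u = - ((MAX i. l $ i) / ln (C (\<chi> i. exp (- (l $ i)))))"
      using that tail_ratio_eq[OF assms, of l]
      by (intro eventually_at_rightI[of 0 1]) (auto simp: tail_directions_def)
  qed
  then show ?thesis
    unfolding has_weak_lower_tail_dependence_def weak_lower_tail_dependence_def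
    using tendsto_Lim[OF trivial_limit_at_right_real lim] by blast
qed

end
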